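(* Let $k\ge 4$ and let $n$ be a non-negative integer whose binary class is $k$-dimensional, $\overline{n}=[\alpha_k,\dots,\alpha_1]$ with $\alpha_k\ge 1$. Set $m=\lfloor\log_2 k\rfloor-1$. If $\alpha_k\ge m$, then $$f(n)=S(\overline{n})+(2^m-1)2^h+\frac{(k-h)(k-h-1)}{2}-mk,$$ where $h\ge 1$ is the integer such that $(2^m-1)2^{h-1}+h+1\le k\le (2^m-1)2^h+h+1$.
   Context: Consider the directed graph whose vertices are the non-negative integers, with an edge $n\to n-2^s$ ($s\ge 0$) whenever the $2^s$-bit in the binary expansion of $n$ is $0$ and $n-2^s\ge 0$. $f(n)$ denotes the length (number of edges) of the longest directed path starting at $n$. The binary class of $n$ is the set of all non-negative integers $m$ whose binary representation agrees with that of $n$ after all trailing $1$'s have been removed from both; $\overline{n}$ denotes its minimal element, i.e. $n$ with all trailing $1$'s deleted ($\overline{n}=0$ if $n=2^t-1$). Bracket form: for integers $\alpha_j\ge 0$, $[\alpha_k,\dots,\alpha_1]$ denotes the number whose binary string is $1^{\alpha_k}0\,1^{\alpha_{k-1}}0\cdots 1^{\alpha_1}0$ ($1^{\alpha}$ means $\alpha$ consecutive digits $1$). The class of $n$ is $k$-dimensional if $\overline{n}=[\alpha_k,\dots,\alpha_1]$ with $\alpha_k\ge 1$. Then $S(\overline{n})=\sum_{j=1}^k j\alpha_j$. *)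

theory Defs
  imports Complex_Main
begin

text \<open>The edges of the directed graph on the non-negative integers. The bound \<open>2 ^ s \<le> n\<close> says
  that \<open>n - 2 ^ s\<close> is non-negative; subtraction on \<^typ>\<open>nat\<close> would otherwise truncate.\<close>

definition edges :: "(nat \<times> nat) set" where
  "edges = {(n, n - 2 ^ s) | n s. \<not> bit n s \<and> 2 ^ s \<le> n}"

text \<open>Edges strictly decrease the vertex, so every walk is a path, and \<open>(n, v) \<in> edges ^^ l\<close> says
  that there is a directed path with \<open>l\<close> edges from \<open>n\<close> to \<open>v\<close>. The maximum is taken over a
  finite non-empty set by the two lemmas below.\<close>

definition longest_path :: "nat \<Rightarrow> nat" where
  "longest_path n = Max {l. \<exists>v. (n, v) \<in> edges ^^ l}"

lemma path_length_bound: "(n, v) \<in> edges ^^ l \<Longrightarrow> l + v \<le> n"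
proof (induction l arbitrary: v)
  case 0
  then show ?case by simp
next
  case (Suc l)
  then obtain u where u: "(n, u) \<in> edges ^^ l" "(u, v) \<in> edges"
    by auto
  obtain s where "v = u - 2 ^ s" "2 ^ s \<le> u"
    using u(2) by (auto simp: edges_def)
  moreover have "(0::nat) < 2 ^ s" by simp
  ultimately have "v < u" by linarith
  with Suc.IH[OF u(1)] show ?case by linarith
qed

lemma finite_path_lengths: "finite {l. \<exists>v. (n, v) \<in> edges ^^ l}"
  by (rule finite_subset[of _ "{..n}"]) (auto dest: path_length_bound)

lemma zero_path_length: "0 \<in> {l. \<exists>v. (n, v) \<in> edges ^^ l}"
  by auto

text \<open>Delete all trailing \<open>1\<close>s of the binary representation. A number \<open>2 ^ t - 1\<close> becomes the
  empty string, which is identified with \<open>0\<close>.\<close>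

function strip_ones :: "nat \<Rightarrow> nat" where
  "strip_ones n = (if odd n then strip_ones (n div 2) else n)"
  by auto
termination
  by (relation "measure id") (auto elim: oddE)

declare strip_ones.simps [simp del]

definition binary_class :: "nat \<Rightarrow> nat set" where
  "binary_class n = {m. strip_ones m = strip_ones n}"

definition class_min :: "nat \<Rightarrow> nat" where
  "class_min n = (LEAST m. m \<in> binary_class n)"

lemma strip_ones_le: "strip_ones n \<le> n"
proof (induction n rule: strip_ones.induct)
  case (1 n)
  then show ?case
    by (subst strip_ones.simps) (auto intro: order_trans[OF _ div_le_dividend])
qed

lemma even_strip_ones: "even (strip_ones n)"
proof (induction n rule: strip_ones.induct)
  case (1 n)
  then show ?case
    by (subst strip_ones.simps) auto
qed

lemma class_min_eq_strip_ones: "class_min n = strip_ones n"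
  unfolding class_min_def
proof (rule Least_equality)
  show "strip_ones n \<in> binary_class n"
    using even_strip_ones[of n] by (simp add: binary_class_def strip_ones.simps[of "strip_ones n"])
  show "strip_ones n \<le> m" if "m \<in> binary_class n" for m
    using that strip_ones_le[of m] by (simp add: binary_class_def)
qed

text \<open>The bracket \<open>[\<alpha>\<^sub>k, \<dots>, \<alpha>\<^sub>1]\<close>, with \<open>\<alpha>\<^sub>j\<close> given as \<open>\<alpha> j\<close> for \<open>1 \<le> j \<le> k\<close>. The bits are listed
  with the most significant one first, as in the written string, whereas \<^const>\<open>horner_sum\<close>
  expects the least significant one first.\<close>

definition bracket_bits :: "nat \<Rightarrow> (nat \<Rightarrow> nat) \<Rightarrow> bool list" where
  "bracket_bits k \<alpha> = concat (map (\<lambda>j. replicate (\<alpha> j) True @ [False]) (rev [1..<Suc k]))"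

definition bracket :: "nat \<Rightarrow> (nat \<Rightarrow> nat) \<Rightarrow> nat" where
  "bracket k \<alpha> = horner_sum of_bool 2 (rev (bracket_bits k \<alpha>))"

text \<open>The class of \<open>n\<close> is \<open>k\<close>-dimensional, with bracket coefficients \<open>\<alpha>\<close>.\<close>

definition k_dimensional :: "nat \<Rightarrow> (nat \<Rightarrow> nat) \<Rightarrow> nat \<Rightarrow> bool" where
  "k_dimensional k \<alpha> n \<longleftrightarrow> class_min n = bracket k \<alpha> \<and> \<alpha> k \<ge> 1"

text \<open>\<open>S\<close> of the number \<open>[\<alpha>\<^sub>k, \<dots>, \<alpha>\<^sub>1]\<close>, as a function of its coefficients, which the number
  determines once \<open>\<alpha>\<^sub>k \<ge> 1\<close>.\<close>

definition S_sum :: "nat \<Rightarrow> (nat \<Rightarrow> nat) \<Rightarrow> nat" where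
  "S_sum k \<alpha> = (\<Sum>j = 1..k. j * \<alpha> j)"

end

theory Submission
  imports Defs
begin

text \<open>Cut the binary string of \<open>n\<close> above its lowest \<open>T\<close> digits, let \<open>V\<close> be the number formed by the
  upper part, and give every zero in the lower part the number of lower positions above it as its
  weight. The sum of \<open>V\<close> and all weights drops along every edge, so it bounds \<open>f(n)\<close> from above for
  every \<open>T\<close>. If the lower part has \<open>z\<close> zeros with \<open>V / 2 \<le> z \<le> V + 1\<close>, there is always a move that
  decreases the sum by exactly one and preserves these inequalities: a swap \<open>10 \<rightarrow> 01\<close> inside the
  lower part, a subtraction of one from an even \<open>V\<close>, or a move that borrows from \<open>V\<close> and turns the top
  zero of the lower part into a one. Then the sum equals \<open>f(n)\<close>. For \<open>2^(c-1) < k \<le> 2^c\<close> the cut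
  leaving \<open>c\<close> upper digits satisfies the inequalities. The hypothesis \<open>\<alpha>\<^sub>k \<ge> m\<close> makes all but the last
  \<open>h = c - m \<in> {1, 2}\<close> of these digits ones, and the values of these last digits do not affect
  the sum once it is expressed through \<open>S\<close>, \<open>k\<close> and \<open>c\<close>.\<close>

section \<open>Weighted zeros below the cut\<close>

definition low_zeros :: "nat \<Rightarrow> nat \<Rightarrow> nat" where
  "low_zeros T n = (\<Sum>q<T. of_bool (\<not> bit n q))"

definition low_weight :: "nat \<Rightarrow> nat \<Rightarrow> nat" where
  "low_weight T n = (\<Sum>q<T. of_bool (\<not> bit n q) * (T - Suc q))"

definition potential :: "nat \<Rightarrow> nat \<Rightarrow> nat" where
  "potential T n = n div 2 ^ T + low_weight T n"

lemma low_zeros_0 [simp]: "low_zeros 0 n = 0"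
  and low_weight_0 [simp]: "low_weight 0 n = 0"
  and potential_0 [simp]: "potential 0 n = n"
  by (simp_all add: low_zeros_def low_weight_def potential_def)

lemma low_zeros_Suc: "low_zeros (Suc T) n = low_zeros T (n div 2) + of_bool (even n)"
  by (simp add: low_zeros_def sum.lessThan_Suc_shift bit_Suc bit_0 del: sum.lessThan_Suc)

lemma low_weight_Suc: "low_weight (Suc T) n = low_weight T (n div 2) + of_bool (even n) * T"
  by (simp add: low_weight_def sum.lessThan_Suc_shift bit_Suc bit_0 del: sum.lessThan_Suc)

text \<open>The inductions on \<open>T\<close> peel off the lowest digit: if it is zero, all
  \<open>T\<close> other lower positions lie above it.\<close>

lemma potential_Suc: "potential (Suc T) n = potential T (n div 2) + of_bool (even n) * T"
  by (simp add: potential_def low_weight_Suc div_mult2_eq)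

lemma low_zeros_Suc_top: "low_zeros (Suc T) n = low_zeros T n + of_bool (\<not> bit n T)"
  by (simp add: low_zeros_def)

text \<open>Raising the cut puts one more position above each old zero; a zero at the new top
  position has weight 0.\<close>

lemma low_weight_Suc_top: "low_weight (Suc T) n = low_weight T n + low_zeros T n"
proof -
  have "low_weight (Suc T) n = (\<Sum>q<T. of_bool (\<not> bit n q) * (Suc T - Suc q))"
    by (simp add: low_weight_def)
  also have "\<dots> = (\<Sum>q<T. of_bool (\<not> bit n q) * (T - Suc q) + of_bool (\<not> bit n q))"
    by (intro sum.cong) auto
  finally show ?thesis
    unfolding low_weight_def low_zeros_def sum.distrib .
qed

lemma low_zeros_cong: "\<forall>q<T. bit m q = bit n q \<Longrightarrow> low_zeros T m = low_zeros T n"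
  unfolding low_zeros_def by (intro sum.cong) auto

lemma low_weight_cong: "\<forall>q<T. bit m q = bit n q \<Longrightarrow> low_weight T m = low_weight T n"
  unfolding low_weight_def by (intro sum.cong) auto

lemma low_weight_above_ones:
  assumes "\<forall>q. T \<le> q \<and> q < T + i \<longrightarrow> bit n q"
  shows "low_zeros (T + i) n = low_zeros T n"
    and "low_weight (T + i) n = low_weight T n + i * low_zeros T n"
  using assms by (induction i) (auto simp: low_zeros_Suc_top low_weight_Suc_top)

section \<open>The potential as an upper bound\<close>

lemma minus_double_div_2: "(n - 2 * m) div 2 = n div 2 - m" for n m :: nat
  by (simp add: div_nat_eqI)

lemma even_minus_1_div_2: "even n \<Longrightarrow> (n - 1) div 2 = n div 2 - 1" for n :: nat
  by (auto elim!: evenE)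

lemma power_Suc_le_iff: "2 ^ Suc s \<le> n \<longleftrightarrow> 2 ^ s \<le> n div 2" for n :: nat
  by (simp add: less_eq_div_iff_mult_less_eq mult.commute)

lemma power_Suc_le_even: "2 ^ s \<le> n div 2 \<Longrightarrow> 2 * 2 ^ s \<le> n" for n :: nat
  by (simp add: less_eq_div_iff_mult_less_eq mult.commute)

text \<open>The borrow fills the trailing zeros and creates a single new zero. Below the cut its
  weight is less than \<open>T\<close>; a borrow that passes the cut lowers the upper part
  instead.\<close>

lemma potential_pred: "1 \<le> x \<Longrightarrow> potential T (x - 1) < potential T x + T"
proof (induction T arbitrary: x)
  case 0
  then show ?case by simp
next
  case (Suc T)
  show ?case
  proof (cases "even x")
    case True
    then have "1 \<le> x div 2" using Suc.prems by (auto elim!: evenE)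
    from Suc.IH[OF this] True Suc.prems show ?thesis
      by (simp add: potential_Suc even_minus_1_div_2[simplified])
  next
    case False
    then have "(x - 1) div 2 = x div 2" by (auto elim!: oddE)
    with False show ?thesis by (simp add: potential_Suc)
  qed
qed

text \<open>For \<open>s < T\<close> the edge fills a zero of weight \<open>T - Suc s\<close> and
  subtracts one from the digits above it, which by \<open>potential_pred\<close> regains less than
  that weight. For \<open>T \<le> s\<close> only the upper part changes, and it drops.\<close>

lemma potential_edge: "(n, v) \<in> edges \<Longrightarrow> potential T v < potential T n"
proof -
  have "potential T (n - 2 ^ s) < potential T n" if "\<not> bit n s" "2 ^ s \<le> n" for s
    using that
  proof (induction T arbitrary: n s)
    case 0
    then show ?case by (simp add: diff_less order_less_le_trans[of 0 "2 ^ s" n])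
  next
    case (Suc T)
    show ?case
    proof (cases s)
      case 0
      with Suc.prems have "even n" "1 \<le> n div 2" 
        by (auto simp: bit_0 elim!: evenE)
      then show ?thesis
        using 0 Suc.prems potential_pred[of "n div 2" T]
        by (simp add: potential_Suc even_minus_1_div_2[simplified])
    next
      case (Suc s')
      with Suc.prems have "\<not> bit (n div 2) s'" "2 ^ s' \<le> n div 2"
        by (simp_all add: bit_Suc power_Suc_le_iff[simplified])
      with Suc.IH[OF this] Suc Suc.prems show ?thesis
        by (simp add: potential_Suc minus_double_div_2)
    qed
  qed
  then show "(n, v) \<in> edges \<Longrightarrow> potential T v < potential T n"
    by (auto simp: edges_def)
qed

lemma longest_path_le_potential: "longest_path n \<le> potential T n"
proof -
  have "l + potential T v \<le> potential T n" if "(n, v) \<in> edges ^^ l" for l v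
    using that
  proof (induction l arbitrary: v)
    case (Suc l)
    then obtain u where "(n, u) \<in> edges ^^ l" "(u, v) \<in> edges" by auto
    with Suc.IH[of u] potential_edge[of u v T] show ?case by simp
  qed simp
  then have "l \<le> potential T n" if "\<exists>v. (n, v) \<in> edges ^^ l" for l
    using that by fastforce
  moreover have "{l. \<exists>v. (n, v) \<in> edges ^^ l} \<noteq> {}"
    using zero_path_length by blast
  ultimately show ?thesis
    unfolding longest_path_def by (simp add: finite_path_lengths)
qed

section \<open>Moves that lower the potential by exactly one\<close>

text \<open>The digits 10 at \<open>Suc q\<close> and \<open>q\<close> become 01, so one zero moves
  up a position and loses one unit of weight.\<close>

lemma swap_move:
  assumes "\<not> bit n q" "bit n (Suc q)" "Suc q < T"
  shows "2 ^ q \<le> n" "potential T n = Suc (potential T (n - 2 ^ q))"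
    "low_zeros T (n - 2 ^ q) = low_zeros T n" "(n - 2 ^ q) div 2 ^ T = n div 2 ^ T"
proof -
  have "2 ^ q \<le> n \<and> potential T n = Suc (potential T (n - 2 ^ q)) \<and>
    low_zeros T (n - 2 ^ q) = low_zeros T n \<and> (n - 2 ^ q) div 2 ^ T = n div 2 ^ T"
    using assms
  proof (induction q arbitrary: n T)
    case 0
    then obtain T' where T: "T = Suc (Suc T')"
      by (metis less_imp_Suc_add add_Suc plus_nat.add_0)
    from 0 obtain a where "n = 4 * a + 2"
      by (auto simp: bit_0 bit_Suc elim!: evenE oddE)
    moreover have "(4 * a + 2) div 2 = 2 * a + 1" "(4 * a + 1) div 2 = 2 * a"
      "(2 * a + 1) div 2 = a" by auto
    moreover have "(4 * a + 2) div 4 = a" "(4 * a + 1) div 4 = a" by auto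
    ultimately show ?case
      by (simp add: T potential_Suc low_zeros_Suc div_mult2_eq)
  next
    case (Suc q)
    then obtain T' where T: "T = Suc T'" by (cases T) auto
    have "\<not> bit (n div 2) q" "bit (n div 2) (Suc q)" "Suc q < T'"
      using Suc.prems T by (simp_all add: bit_Suc)
    note IH = Suc.IH[OF this]
    then have "2 * 2 ^ q \<le> n" by (intro power_Suc_le_even) simp
    with IH show ?case
      by (simp add: T potential_Suc low_zeros_Suc div_mult2_eq minus_double_div_2)
  qed
  then show "2 ^ q \<le> n" "potential T n = Suc (potential T (n - 2 ^ q))"
    "low_zeros T (n - 2 ^ q) = low_zeros T n" "(n - 2 ^ q) div 2 ^ T = n div 2 ^ T"
    by auto
qed

text \<open>Position \<open>T\<close> holds the lowest digit of the upper part, so the move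
  subtracts one from that part and leaves the lower part alone.\<close>

lemma inner_move:
  assumes "\<not> bit n T" "2 ^ T \<le> n"
  shows "potential T n = Suc (potential T (n - 2 ^ T))"
    "low_zeros T (n - 2 ^ T) = low_zeros T n" "(n - 2 ^ T) div 2 ^ T = n div 2 ^ T - 1"
proof -
  have "potential T n = Suc (potential T (n - 2 ^ T)) \<and>
    low_zeros T (n - 2 ^ T) = low_zeros T n \<and> (n - 2 ^ T) div 2 ^ T = n div 2 ^ T - 1"
    using assms
  proof (induction T arbitrary: n)
    case 0
    then show ?case by simp
  next
    case (Suc T)
    have "\<not> bit (n div 2) T" "2 ^ T \<le> n div 2"
      using Suc.prems by (simp_all add: bit_Suc power_Suc_le_iff[simplified])
    from Suc.IH[OF this] Suc.prems show ?case
      by (simp add: potential_Suc low_zeros_Suc div_mult2_eq minus_double_div_2)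
  qed
  then show "potential T n = Suc (potential T (n - 2 ^ T))"
    "low_zeros T (n - 2 ^ T) = low_zeros T n" "(n - 2 ^ T) div 2 ^ T = n div 2 ^ T - 1"
    by auto
qed

text \<open>With the cut at \<open>Suc T\<close>, the zero at \<open>T\<close> has weight 0, so
  filling it is free and the whole decrease is the one borrowed from the upper part.\<close>

lemma crossing_move:
  assumes "\<not> bit n T" "2 ^ T \<le> n"
  shows "potential (Suc T) n = Suc (potential (Suc T) (n - 2 ^ T))"
    "low_zeros (Suc T) n = Suc (low_zeros (Suc T) (n - 2 ^ T))"
    "(n - 2 ^ T) div 2 ^ Suc T = n div 2 ^ Suc T - 1"
proof -
  have "potential (Suc T) n = Suc (potential (Suc T) (n - 2 ^ T)) \<and>
    low_zeros (Suc T) n = Suc (low_zeros (Suc T) (n - 2 ^ T))"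
    using assms
  proof (induction T arbitrary: n)
    case 0
    then show ?case
      by (auto simp: potential_Suc low_zeros_Suc bit_0 elim!: evenE)
  next
    case (Suc T)
    have "\<not> bit (n div 2) T" "2 ^ T \<le> n div 2"
      using Suc.prems by (simp_all add: bit_Suc power_Suc_le_iff[simplified])
    from Suc.IH[OF this] Suc.prems show ?case
      by (simp add: potential_Suc[of "Suc T"] low_zeros_Suc[of "Suc T"] minus_double_div_2)
  qed
  then show "potential (Suc T) n = Suc (potential (Suc T) (n - 2 ^ T))"
    "low_zeros (Suc T) n = Suc (low_zeros (Suc T) (n - 2 ^ T))"
    by auto
  \<comment> \<open>Seen from the cut at \<open>T\<close> this is an \<open>inner_move\<close> on an
    even upper part.\<close>
  have "even (n div 2 ^ T)" "(n - 2 ^ T) div 2 ^ T = n div 2 ^ T - 1"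
    using assms inner_move(3)[of n T] by (simp_all add: bit_iff_odd)
  then show "(n - 2 ^ T) div 2 ^ Suc T = n div 2 ^ Suc T - 1"
    by (simp only: power_Suc2 div_mult2_eq even_minus_1_div_2)
qed

section \<open>Attaining the bound\<close>

text \<open>Climbing from the zero at \<open>q\<close>, the first one met, at \<open>T\<close> at
  the latest, sits directly above a zero.\<close>

lemma ex_descent:
  assumes "bit n T" "\<not> bit n q" "q < T"
  shows "\<exists>p. \<not> bit n p \<and> bit n (Suc p) \<and> Suc p \<le> T"
proof -
  have "\<exists>p\<ge>q. p < T \<and> \<not> bit n p \<and> bit n (Suc p)"
    using assms
  proof (induction "T - q" arbitrary: q)
    case (Suc d)
    show ?case
    proof (cases "bit n (Suc q)")
      case True
      with Suc.prems show ?thesis by blast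
    next
      case False
      then have "Suc q < T" using Suc.prems by (metis Suc_lessI)
      with False Suc show ?thesis
        using Suc.hyps(1)[of "Suc q"] by (metis Suc_leD Suc_diff_Suc nat.inject)
    qed
  qed simp
  then show ?thesis by auto
qed

lemma low_zeros_eq_0_iff: "low_zeros T n = 0 \<longleftrightarrow> (\<forall>q<T. bit n q)"
  by (auto simp: low_zeros_def)

lemma low_weight_eq_0: "low_zeros T n = 0 \<Longrightarrow> low_weight T n = 0"
  by (auto simp: low_zeros_eq_0_iff low_weight_def)

lemma unit_step:
  assumes "n div 2 ^ T \<le> 2 * low_zeros T n" "low_zeros T n \<le> Suc (n div 2 ^ T)"
    and "potential T n \<noteq> 0"
  obtains v where "(n, v) \<in> edges" "potential T n = Suc (potential T v)"
    "v div 2 ^ T \<le> 2 * low_zeros T v" "low_zeros T v \<le> Suc (v div 2 ^ T)"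
proof -
  let ?V = "n div 2 ^ T" and ?z = "low_zeros T n"
  have edge: "(n, n - 2 ^ s) \<in> edges" if "\<not> bit n s" "2 ^ s \<le> n" for s
    using that by (auto simp: edges_def)
  have bit_T: "bit n T \<longleftrightarrow> odd ?V"
    by (simp add: bit_iff_odd)
  have pos: "2 ^ T \<le> n" if "?V \<noteq> 0"
    using that by (metis div_less not_le)
  show ?thesis
  proof (cases "even ?V \<and> ?V \<noteq> 0 \<and> ?z \<le> ?V")
    case True
    with bit_T pos have *: "\<not> bit n T" "2 ^ T \<le> n" by auto
    show ?thesis
      using that[of "n - 2 ^ T"] edge[OF *] inner_move[OF *] True assms by auto
  next
    case False
    \<comment> \<open>Without zeros below the cut, the first inequality forces \<open>?V = 0\<close>
      and the potential vanishes.\<close>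
    have "?z \<noteq> 0"
    proof
      assume "?z = 0"
      with assms have "potential T n = 0" by (simp add: potential_def low_weight_eq_0)
      with assms show False by simp
    qed
    then obtain T' where T: "T = Suc T'" by (cases T) auto
    show ?thesis
    proof (cases "bit n T'")
      case True
      from \<open>?z \<noteq> 0\<close> obtain q where q: "q < T" "\<not> bit n q"
        by (auto simp: low_zeros_eq_0_iff)
      with True T have "q < T'" by (metis less_SucE)
      with ex_descent[OF True q(2)] obtain p where "\<not> bit n p" "bit n (Suc p)" "Suc p < T"
        using T by auto
      note * = this
      show ?thesis
        using that[of "n - 2 ^ p"] edge[OF *(1)] swap_move[OF *] assms by auto
    next
      case bit: False
      show ?thesis
      proof (cases "?V = 0")
        case True
        \<comment> \<open>For \<open>?V = 0\<close> the second inequality allows one zero only, the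
          one at \<open>T'\<close>, which has weight 0.\<close>
        with assms bit have "low_zeros T' n = 0"
          by (simp add: T low_zeros_Suc_top)
        then have "potential T n = 0"
          using True by (simp add: potential_def T low_weight_Suc_top low_weight_eq_0)
        with assms show ?thesis by simp
      next
        case V: False
        then have "2 ^ T' \<le> n" using pos T by simp
        note * = crossing_move[OF bit this, folded T]
        \<comment> \<open>The crossing lowers \<open>V\<close> and \<open>z\<close> by one each and
          could violate the first inequality only if \<open>V = 2 * z\<close>. Then \<open>V\<close>
          is even, nonzero and at least \<open>z\<close>, the excluded case of the inner
          move.\<close>
        have "V \<le> 2 * z - 1 \<or> z = Suc V"
          if "\<not> (even V \<and> V \<noteq> 0 \<and> z \<le> V)" "V \<noteq> 0" "V \<le> 2 * z" "z \<le> Suc V" for V z :: nat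
          using that by presburger
        from this[OF False V assms(1,2)] V have "?V \<le> 2 * ?z - 1 \<or> ?z = Suc ?V" "?V \<ge> 1"
          by auto
        then show ?thesis
          using that[of "n - 2 ^ T'"] edge[OF bit \<open>2 ^ T' \<le> n\<close>] * assms by auto
      qed
    qed
  qed
qed

lemma longest_path_eq_potential:
  assumes "n div 2 ^ T \<le> 2 * low_zeros T n" "low_zeros T n \<le> Suc (n div 2 ^ T)"
  shows "longest_path n = potential T n"
proof (rule antisym[OF longest_path_le_potential])
  have "\<exists>v. (n, v) \<in> edges ^^ potential T n"
    using assms
  proof (induction "potential T n" arbitrary: n)
    case 0
    then show ?case by auto
  next
    case (Suc l)
    then obtain u where u: "(n, u) \<in> edges" "potential T n = Suc (potential T u)"
      "u div 2 ^ T \<le> 2 * low_zeros T u" "low_zeros T u \<le> Suc (u div 2 ^ T)"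
      by (metis unit_step nat.distinct(1))
    with Suc obtain v where "(u, v) \<in> edges ^^ potential T u" by auto
    with u(1) have "(n, v) \<in> edges ^^ Suc (potential T u)" by (rule relpow_Suc_I2)
    with u(2) show ?case by metis
  qed
  then show "potential T n \<le> longest_path n"
    unfolding longest_path_def by (simp add: finite_path_lengths)
qed


section \<open>Trailing ones and bracket strings\<close>

text \<open>Trailing ones carry no weight, so restoring \<open>t\<close> of them and raising the cut
  by \<open>t\<close> changes nothing in the criterion; the class minimum can stand in for
  \<open>n\<close>.\<close>

lemma strip_ones_invariants:
  "\<exists>t. potential (T + t) n = potential T (strip_ones n) \<and>
     low_zeros (T + t) n = low_zeros T (strip_ones n) \<and>
     n div 2 ^ (T + t) = strip_ones n div 2 ^ T"
proof (induction n rule: strip_ones.induct)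
  case (1 n)
  show ?case
  proof (cases "odd n")
    case True
    with 1 obtain t where "potential (T + t) (n div 2) = potential T (strip_ones (n div 2))"
      "low_zeros (T + t) (n div 2) = low_zeros T (strip_ones (n div 2))"
      "n div 2 div 2 ^ (T + t) = strip_ones (n div 2) div 2 ^ T" by blast
    with True show ?thesis
      by (intro exI[of _ "Suc t"])
         (simp add: strip_ones.simps[of n] potential_Suc low_zeros_Suc div_mult2_eq)
  next
    case False
    then show ?thesis
      by (intro exI[of _ 0]) (simp add: strip_ones.simps[of n])
  qed
qed

definition bracket_length :: "nat \<Rightarrow> (nat \<Rightarrow> nat) \<Rightarrow> nat" where
  "bracket_length k \<alpha> = length (bracket_bits k \<alpha>)"

lemma bracket_bits_Suc:
  "bracket_bits (Suc k) \<alpha> = replicate (\<alpha> (Suc k)) True @ False # bracket_bits k \<alpha>"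
  by (simp add: bracket_bits_def)

lemma bracket_length_0: "bracket_length 0 \<alpha> = 0"
  by (simp add: bracket_length_def bracket_bits_def)

lemma bracket_length_Suc:
  "bracket_length (Suc k) \<alpha> = Suc (bracket_length k \<alpha>) + \<alpha> (Suc k)"
  by (simp add: bracket_length_def bracket_bits_Suc)

lemma bracket_length_ge: "k \<le> bracket_length k \<alpha>"
  by (induction k) (auto simp: bracket_length_Suc)

lemma bit_bracket: "bit (bracket k \<alpha>) q \<longleftrightarrow>
  q < bracket_length k \<alpha> \<and> rev (bracket_bits k \<alpha>) ! q"
  by (simp add: bracket_def bracket_length_def bit_horner_sum_bit_iff)

lemma bracket_less: "bracket k \<alpha> < 2 ^ bracket_length k \<alpha>"
  using horner_sum_bound[of "rev (bracket_bits k \<alpha>)"]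
  by (simp add: bracket_def bracket_length_def)

lemma bit_bracket_Suc:
  "bit (bracket (Suc k) \<alpha>) q \<longleftrightarrow>
     (if q < bracket_length k \<alpha> then bit (bracket k \<alpha>) q
      else bracket_length k \<alpha> < q \<and> q < bracket_length (Suc k) \<alpha>)"
proof (cases "q \<le> bracket_length k \<alpha>")
  case True
  then show ?thesis
    by (auto simp: bit_bracket bracket_bits_Suc bracket_length_def nth_append)
next
  case False
  then show ?thesis
    by (auto simp: bit_bracket bracket_bits_Suc bracket_length_def nth_append)
qed

text \<open>The weight counts pairs of a zero and a position above it. A one of block
  \<open>j\<close> lies above \<open>j\<close> zeros, which gives \<open>S_sum\<close>; pairs of
  zeros give the other sum.\<close>

lemma bracket_low:
  "low_zeros (bracket_length k \<alpha>) (bracket k \<alpha>) = k"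
  "low_weight (bracket_length k \<alpha>) (bracket k \<alpha>) = S_sum k \<alpha> + (\<Sum>j<k. j)"
proof (induction k)
  case 0
  {
    case 1
    then show ?case by (simp add: bracket_length_0)
  next
    case 2
    then show ?case by (simp add: bracket_length_0 S_sum_def)
  }
next
  case (Suc k)
  let ?P = "bracket_length k \<alpha>" and ?n = "bracket (Suc k) \<alpha>"
  have eq: "\<forall>q<?P. bit ?n q = bit (bracket k \<alpha>) q"
    by (simp add: bit_bracket_Suc)
  have zeros: "low_zeros (Suc ?P) ?n = Suc k"
    using low_zeros_cong[OF eq] Suc by (simp add: low_zeros_Suc_top bit_bracket_Suc)
  have weight: "low_weight (Suc ?P) ?n = S_sum k \<alpha> + (\<Sum>j<k. j) + k"
    using low_zeros_cong[OF eq] low_weight_cong[OF eq] Suc by (simp add: low_weight_Suc_top)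
  have ones: "\<forall>q. Suc ?P \<le> q \<and> q < Suc ?P + \<alpha> (Suc k) \<longrightarrow> bit ?n q"
    by (simp add: bit_bracket_Suc bracket_length_Suc)
  {
    case 1
    show ?case
      using low_weight_above_ones(1)[OF ones] zeros by (simp add: bracket_length_Suc)
  next
    case 2
    show ?case
      using low_weight_above_ones(2)[OF ones] zeros weight
      by (simp add: bracket_length_Suc S_sum_def)
  }
qed

lemma bit_bracket_leading:
  assumes "k \<ge> 1" "bracket_length k \<alpha> \<le> q + \<alpha> k" "q < bracket_length k \<alpha>"
  shows "bit (bracket k \<alpha>) q"
proof -
  obtain k' where "k = Suc k'" using assms by (cases k) auto
  with assms show ?thesis by (auto simp: bit_bracket_Suc bracket_length_Suc)
qed

section \<open>Evaluation at the cut leaving \<open>c\<close> upper digits\<close>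

lemma leading_ones_div:
  fixes n :: nat
  assumes "n < 2 ^ (T + i)" "\<forall>q. T \<le> q \<and> q < T + i \<longrightarrow> bit n q"
  shows "n div 2 ^ T = 2 ^ i - 1"
proof -
  have "drop_bit T n = mask i"
  proof (rule bit_eqI)
    fix j
    have "take_bit (T + i) n = n" using assms(1) by (simp add: take_bit_nat_eq_self_iff)
    then have "bit n (T + j) \<Longrightarrow> T + j < T + i"
      by (metis bit_take_bit_iff)
    then show "bit (drop_bit T n) j \<longleftrightarrow> bit (mask i :: nat) j"
      using assms(2) by (auto simp: bit_drop_bit_eq bit_mask_iff)
  qed
  then show ?thesis by (simp add: drop_bit_eq_div mask_eq_exp_minus_1)
qed

lemma div_power_split:
  "n div 2 ^ T = 2 * (n div 2 ^ Suc T) + of_bool (bit n T)" for n :: nat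
proof -
  have "n div 2 ^ Suc T = n div 2 ^ T div 2"
    by (simp only: power_Suc2 div_mult2_eq)
  then show ?thesis
    by (simp add: bit_iff_odd)
qed

lemma longest_path_formula:
  assumes k: "1 \<le> k" "k \<le> 2 ^ c" "2 ^ c < 2 * k"
    and c: "2 \<le> c" "c \<le> k" "c \<le> \<alpha> k + 2" "k = 2 ^ c \<Longrightarrow> c \<le> Suc (\<alpha> k)"
    and n: "k_dimensional k \<alpha> n"
  shows "longest_path n + c * k + 1 = 2 ^ c + S_sum k \<alpha> + (\<Sum>j<k. j)"
proof -
  define b where "b = bracket k \<alpha>"
  define P where "P = bracket_length k \<alpha>"
  define T where "T = P - c"
  obtain i where i: "c = Suc (Suc i)" using c(1) by (metis add_2_eq_Suc le_Suc_ex)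
  have "c \<le> P" using c(2) bracket_length_ge[of k \<alpha>] by (simp add: P_def)
  then have P: "P = Suc (Suc T) + i" by (simp add: T_def i)
  have ones: "\<forall>q. Suc (Suc T) \<le> q \<and> q < Suc (Suc T) + i \<longrightarrow> bit b q"
    using bit_bracket_leading[of k \<alpha>] k c(3) P by (auto simp: b_def P_def i)
  have bT: "bit b (Suc T)" if "k = 2 ^ c"
    using bit_bracket_leading[of k \<alpha> "Suc T"] k c(4)[OF that] P by (auto simp: b_def P_def i)
  \<comment> \<open>Only the digits at \<open>T\<close> and \<open>Suc T\<close> are unknown. With z
    zeros below \<open>T\<close> and upper part V, \<open>z = k - u - v\<close> and
    \<open>V = 2 ^ c - 1 - u - 2 * v\<close>. Raising the cut from \<open>T\<close> to
    \<open>P\<close> adds z, then \<open>z + u\<close>, then \<open>k\<close> for each of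
    \<open>i\<close> ones; \<open>u\<close> and \<open>v\<close> cancel in the potential.\<close>
  define u v :: nat where "u = of_bool (\<not> bit b T)" and "v = of_bool (\<not> bit b (Suc T))"
  have zeros: "k = low_zeros T b + u + v"
    using low_weight_above_ones(1)[OF ones, folded P] bracket_low(1)[of k \<alpha>]
    by (simp add: low_zeros_Suc_top u_def v_def flip: b_def P_def)
  have weight: "S_sum k \<alpha> + (\<Sum>j<k. j) = low_weight T b + low_zeros T b
      + (low_zeros T b + u) + i * k"
    using low_weight_above_ones[OF ones, folded P] bracket_low[of k \<alpha>]
    by (simp add: low_weight_Suc_top low_zeros_Suc_top u_def flip: b_def P_def)
  obtain y where y: "2 ^ i = Suc y" by (metis not0_implies_Suc power_not_zero zero_neq_numeral)
  then have pow: "2 ^ c = 4 * y + 4" by (simp add: i)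
  have "b div 2 ^ Suc (Suc T) = 2 ^ i - 1"
    using bracket_less[of k \<alpha>] ones by (intro leading_ones_div) (simp_all add: b_def P flip: P_def)
  then have V: "b div 2 ^ T + 2 * v + u = 4 * y + 3"
    using div_power_split[of b T] div_power_split[of b "Suc T"] by (simp add: u_def v_def y)
  have uv: "u \<le> 1" "v \<le> 1" by (simp_all add: u_def v_def)
  \<comment> \<open>The second inequality of the criterion amounts to
    \<open>k + v \<le> 2 ^ c\<close>; this is why \<open>k = 2 ^ c\<close> needs one more leading
    one.\<close>
  have kv: "k + v \<le> 4 * y + 4"
  proof (cases "k = 2 ^ c")
    case True
    with bT pow show ?thesis by (simp add: v_def)
  next
    case False
    with k(2) pow uv show ?thesis by linarith
  qed
  have "strip_ones n = b"
    using n by (simp add: k_dimensional_def class_min_eq_strip_ones b_def)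
  with strip_ones_invariants[of T n] obtain t where t: "potential (T + t) n = potential T b"
    "low_zeros (T + t) n = low_zeros T b" "n div 2 ^ (T + t) = b div 2 ^ T"
    by blast
  have "longest_path n = potential (T + t) n"
  proof (rule longest_path_eq_potential)
    show "n div 2 ^ (T + t) \<le> 2 * low_zeros (T + t) n"
      unfolding t using zeros V pow k(3) uv by linarith
    show "low_zeros (T + t) n \<le> Suc (n div 2 ^ (T + t))"
      unfolding t using zeros V kv by linarith
  qed
  also have "\<dots> = b div 2 ^ T + low_weight T b" unfolding t(1) by (rule potential_def)
  finally have "longest_path n = b div 2 ^ T + low_weight T b" .
  moreover have "c * k = i * k + 2 * k" by (simp add: i)
  ultimately show ?thesis
    using zeros weight V pow by linarith
qed

section \<open>The value of \<open>h\<close> and the closed formula\<close>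

text \<open>For \<open>h = 1\<close> the upper bound is \<open>2 ^ Suc m\<close>, which leaves
  equality only; \<open>h = 2\<close> covers the rest of the range; for \<open>h \<ge> 3\<close> the
  lower bound is at least \<open>2 ^ Suc (Suc m)\<close>.\<close>

lemma ex1_round:
  fixes k m h :: nat
  assumes "1 \<le> m" "2 ^ Suc m \<le> k" "k < 2 ^ Suc (Suc m)"
  shows "h \<ge> 1 \<and> (2 ^ m - 1) * 2 ^ (h - 1) + h + 1 \<le> k \<and> k \<le> (2 ^ m - 1) * 2 ^ h + h + 1
    \<longleftrightarrow> h = (if k = 2 ^ Suc m then 1 else 2)"
proof -
  obtain x where x: "2 ^ m = Suc x" by (metis not0_implies_Suc power_not_zero zero_neq_numeral)
  consider "h = 0" | "h = 1" | "h = 2" | "h \<ge> 3" by linarith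
  then show ?thesis
  proof cases
    case 4
    have "2 ^ 2 * x \<le> 2 ^ (h - 1) * x" using 4 by (intro mult_right_mono power_increasing) auto
    moreover have "k < 2 ^ 2 * x + 4" using assms x by simp
    ultimately have "k < x * 2 ^ (h - 1) + h + 1" using 4 by (simp only: mult.commute)
    with 4 x show ?thesis by simp
  qed (use assms x in auto)
qed

theorem theorem1p4:
  fixes k n m :: nat and \<alpha> :: "nat \<Rightarrow> nat"
  assumes "k \<ge> 4"
    and "k_dimensional k \<alpha> n"
    and "int m = \<lfloor>log 2 (real k)\<rfloor> - 1"
    and "\<alpha> k \<ge> m"
  shows "(\<exists>!h::nat. h \<ge> 1 \<and> (2 ^ m - 1) * 2 ^ (h - 1) + h + 1 \<le> k \<and> k \<le> (2 ^ m - 1) * 2 ^ h + h + 1) \<and>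
    (\<forall>h::nat. h \<ge> 1 \<and> (2 ^ m - 1) * 2 ^ (h - 1) + h + 1 \<le> k \<and> k \<le> (2 ^ m - 1) * 2 ^ h + h + 1 \<longrightarrow>
      real (longest_path n) = real (S_sum k \<alpha>) + (2 ^ m - 1) * 2 ^ h
        + (real k - real h) * (real k - real h - 1) / 2 - real m * real k)"
proof -
  have "\<lfloor>log 2 (real k)\<rfloor> = int (Suc m)" using assms(3) by simp
  then have lower: "2 ^ Suc m \<le> k" and upper: "k < 2 ^ Suc (Suc m)"
    using assms(1) floor_log_nat_eq_powr_iff[of 2 k "Suc m"] by auto
  have m: "1 \<le> m" using upper assms(1) by (cases m) auto
  define h where "h = (if k = 2 ^ Suc m then 1 else 2 :: nat)"
  have h: "h = 1 \<or> h = 2" by (simp add: h_def)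
  \<comment> \<open>Here \<open>c = m + h\<close>, and the choice of \<open>h\<close> gives
    \<open>2 ^ (c - 1) < k \<le> 2 ^ c\<close>.\<close>
  have "longest_path n + (m + h) * k + 1 = 2 ^ (m + h) + S_sum k \<alpha> + (\<Sum>j<k. j)"
  proof (rule longest_path_formula[OF _ _ _ _ _ _ _ assms(2)])
    have "Suc m < 2 ^ Suc m" by (rule less_exp)
    then show "m + h \<le> k" using lower h by auto
  qed (use assms(1,4) lower upper m in \<open>auto simp: h_def split: if_splits\<close>)
  then have "real (longest_path n) + (real m + real h) * real k + 1
      = 2 ^ (m + h) + real (S_sum k \<alpha>) + real (\<Sum>j<k. j)"
    by (metis of_nat_add of_nat_mult of_nat_power of_nat_numeral of_nat_1)
  moreover have "real (\<Sum>j<k. j) = real k * (real k - 1) / 2"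
    by (induction k) (auto simp: field_simps)
  \<comment> \<open>The two forms agree because \<open>2 ^ h - 1 = h * (h + 1) / 2\<close> for
    \<open>h = 1\<close> and \<open>h = 2\<close>.\<close>
  ultimately have "real (longest_path n) = real (S_sum k \<alpha>) + (2 ^ m - 1) * 2 ^ h
        + (real k - real h) * (real k - real h - 1) / 2 - real m * real k"
    using h by (auto simp: power_add field_simps)
  then show ?thesis
    unfolding ex1_round[OF m lower upper] h_def[symmetric] by blast
qed

end
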